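(* Let $\mu$ be a Borel probability measure on $[0,1)$ and let $x\in[0,1)$ be irrational. (a) Assume that $\mu(B(x,|I_n(x)|))\asymp\mu(I_n(x))$. If $d_\mu(x)$ exists, then $\delta_\mu(x)$ exists and $\delta_\mu(x)=d_\mu(x)$. (b) If $\delta_\mu(x)$ and $\lambda(x)$ both exist, then $d_\mu(x)$ exists and $\delta_\mu(x)=d_\mu(x)$.
   Context: $a_n(x)$ denotes the $n$-th partial quotient of the continued fraction of $x$; $I_n(x)=\{y\in[0,1):a_j(y)=a_j(x),\ 1\le j\le n\}$ is the $n$-th order cylinder containing $x$, an interval of length $|I_n(x)|$; $B(x,r)$ is the ball with center $x$ and radius $r$. The pointwise dimension and the Markov pointwise dimension of $\mu$ at $x$ are $$d_\mu(x)=\lim_{r\to0}\frac{\log\mu(B(x,r))}{\log r},\qquad\delta_\mu(x)=\lim_{n\to\infty}\frac{\log\mu(I_n(x))}{\log|I_n(x)|},$$ when the limits exist. The Lyapunov exponent is $\lambda(x)=\lim_{n\to\infty}\frac1n\log|(T^n)'(x)|$ when the (finite) limit exists, where $T(x)=\frac1x\pmod1$ is the Gauss map. For sequences, $u_n\asymp v_n$ means there are positive constants $c_1,c_2$ with $c_1v_n\le u_n\le c_2v_n$ for all $n$ large enough. *)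

theory Defs
  imports "HOL-Analysis.Analysis" "HOL-Probability.Probability_Measure"
begin

text \<open>At \<open>0\<close> the convention \<open>1 / 0 = 0\<close> gives \<open>gauss_map 0 = 0\<close>, and the partial quotients of a
  rational number are \<open>0\<close> from the point where its continued fraction has terminated.  As proper
  partial quotients are positive, a rational number whose expansion stops before stage \<open>n\<close> lies in
  no \<open>n\<close>-th order cylinder of an irrational number.\<close>

definition gauss_map :: "real \<Rightarrow> real" where
  "gauss_map x = frac (1 / x)"

definition partial_quotient :: "nat \<Rightarrow> real \<Rightarrow> int" where
  "partial_quotient n x = \<lfloor>1 / (gauss_map ^^ (n - 1)) x\<rfloor>"

definition cf_cylinder :: "nat \<Rightarrow> real \<Rightarrow> real set" where
  "cf_cylinder n x =
     {y \<in> {0..<1}. \<forall>j\<in>{1..n}. partial_quotient j y = partial_quotient j x}"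

definition cf_cylinder_length :: "nat \<Rightarrow> real \<Rightarrow> real" where
  "cf_cylinder_length n x = measure lborel (cf_cylinder n x)"

text \<open>Balls and cylinders may have measure \<open>0\<close>, so logarithms of measures are taken with
  \<open>log 0 = -\<infinity>\<close> (the library has \<open>ln 0 = 0\<close>), and dimensions are limits in the extended reals.\<close>

definition log_ext :: "real \<Rightarrow> ereal" where
  "log_ext m = (if m = 0 then -\<infinity> else ereal (ln m))"

text \<open>The ball is intersected with \<open>space M\<close>, which is \<open>[0,1)\<close> for the measures considered here.\<close>

definition ball_measure :: "real measure \<Rightarrow> real \<Rightarrow> real \<Rightarrow> real" where
  "ball_measure M x r = measure M (ball x r \<inter> space M)"

definition pointwise_quotient :: "real measure \<Rightarrow> real \<Rightarrow> real \<Rightarrow> ereal" where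
  "pointwise_quotient M x r = log_ext (ball_measure M x r) / ereal (ln r)"

definition pointwise_dim_exists :: "real measure \<Rightarrow> real \<Rightarrow> bool" where
  "pointwise_dim_exists M x \<longleftrightarrow> (\<exists>d. (pointwise_quotient M x \<longlongrightarrow> d) (at_right 0))"

definition pointwise_dim :: "real measure \<Rightarrow> real \<Rightarrow> ereal" where
  "pointwise_dim M x = Lim (at_right 0) (pointwise_quotient M x)"

definition markov_quotient :: "real measure \<Rightarrow> real \<Rightarrow> nat \<Rightarrow> ereal" where
  "markov_quotient M x n =
     log_ext (measure M (cf_cylinder n x)) / ereal (ln (cf_cylinder_length n x))"

definition markov_dim_exists :: "real measure \<Rightarrow> real \<Rightarrow> bool" where
  "markov_dim_exists M x \<longleftrightarrow> (\<exists>d. markov_quotient M x \<longlonglongrightarrow> d)"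

definition markov_dim :: "real measure \<Rightarrow> real \<Rightarrow> ereal" where
  "markov_dim M x = lim (markov_quotient M x)"

text \<open>Unlike for the dimensions, the limit is required to be finite: the sequence is real-valued.\<close>

definition lyapunov_exists :: "real \<Rightarrow> bool" where
  "lyapunov_exists x \<longleftrightarrow> convergent (\<lambda>n. (1 / real n) * ln \<bar>deriv (gauss_map ^^ n) x\<bar>)"

definition comparable :: "(nat \<Rightarrow> real) \<Rightarrow> (nat \<Rightarrow> real) \<Rightarrow> bool" where
  "comparable u v \<longleftrightarrow>
     (\<exists>c1>0. \<exists>c2>0. \<forall>\<^sub>F n in sequentially. c1 * v n \<le> u n \<and> u n \<le> c2 * v n)"

end

theory Submission
  imports Defs "HOL-Real_Asymp.Real_Asymp"
begin

text \<open>Write \<open>T\<close> for the Gauss map and \<open>w\<^sub>n\<close> for the product of the \<open>1 / T\<^sup>k x\<close> over \<open>k < n\<close>, so that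
  \<open>\<bar>(T\<^sup>n)'(x)\<bar> = w\<^sub>n\<^sup>2\<close> and \<open>w\<^sub>n = q\<^sub>n + q\<^sub>n\<^sub>-\<^sub>1 T\<^sup>n x\<close>.  The length of the \<open>n\<close>-th cylinder is
  \<open>1 / (q\<^sub>n (q\<^sub>n + q\<^sub>n\<^sub>-\<^sub>1))\<close>, which is \<open>w\<^sub>n\<^sup>-\<^sup>2\<close> up to a factor \<open>2\<close>.  It tends to \<open>0\<close>, so in part (a)
  the Markov quotients are, up to \<open>O(1) / ln |I\<^sub>n(x)|\<close>, the pointwise quotients along the radii
  \<open>|I\<^sub>n(x)|\<close>.  For part (b), the distance from \<open>x\<close> to the complement of the cylinder is at least
  \<open>w\<^sub>n\<^sub>+\<^sub>2\<^sup>-\<^sup>2 / 2\<close>, so that \<open>B(x, w\<^sub>n\<^sub>+\<^sub>2\<^sup>-\<^sup>2 / 2) \<subseteq> I\<^sub>n(x) \<subseteq> B(x, 3 w\<^sub>n\<^sup>-\<^sup>2)\<close>.  If the Lyapunov exponent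
  exists it is at least \<open>ln 2 > 0\<close>, hence \<open>ln w\<^sub>n\<close> is asymptotically linear with nonzero slope,
  a bounded shift of \<open>n\<close> does not change it to first order, and the balls can be compared with
  cylinders.\<close>

section \<open>Gauss map\<close>

lemma gauss_map_irrational:
  assumes "x \<notin> \<rat>"
  shows "gauss_map x \<notin> \<rat>" "0 < gauss_map x" "gauss_map x < 1"
proof -
  have "1 / x \<notin> \<rat>"
    using assms Rats_inverse[of "1 / x"] by (auto simp: divide_inverse)
  then show irr: "gauss_map x \<notin> \<rat>"
    unfolding gauss_map_def frac_def
    using Rats_add[of "1 / x - real_of_int \<lfloor>1 / x\<rfloor>" "real_of_int \<lfloor>1 / x\<rfloor>"] by auto
  then have "gauss_map x \<noteq> 0" by auto
  then show "0 < gauss_map x" "gauss_map x < 1"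
    using frac_ge_0[of "1 / x"] frac_lt_1[of "1 / x"] unfolding gauss_map_def by linarith+
qed

lemma gauss_map_iterate_irrational:
  assumes "x \<in> {0..<1}" "x \<notin> \<rat>"
  shows "(gauss_map ^^ k) x \<notin> \<rat> \<and> 0 < (gauss_map ^^ k) x \<and> (gauss_map ^^ k) x < 1"
proof (induction k)
  case 0
  have "x \<noteq> 0" using assms by auto
  then show ?case using assms by auto
next
  case (Suc k)
  then show ?case using gauss_map_irrational[of "(gauss_map ^^ k) x"] by simp
qed

lemma inverse_eq_floor_plus_gauss_map: "1 / x = real_of_int \<lfloor>1 / x\<rfloor> + gauss_map x"
  by (simp add: gauss_map_def frac_def)

lemma gauss_map_has_derivative:
  assumes "x \<notin> \<rat>"
  shows "(gauss_map has_real_derivative - 1 / x\<^sup>2) (at x)"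
proof -
  have x: "x \<noteq> 0" using assms by auto
  have "1 / x \<notin> \<rat>"
    using assms Rats_inverse[of "1 / x"] by (auto simp: divide_inverse)
  then have "1 / x \<notin> \<int>" using Ints_subset_Rats by blast
  then have "((\<lambda>x. real_of_int \<lfloor>1 / x\<rfloor>) has_real_derivative 0) (at x)"
    using x by (intro floor_has_real_derivative continuous_intros) auto
  moreover have "((\<lambda>x. 1 / x) has_real_derivative - 1 / x\<^sup>2) (at x)"
    using x by (auto intro!: derivative_eq_intros simp: power2_eq_square)
  ultimately have "((\<lambda>x. 1 / x - real_of_int \<lfloor>1 / x\<rfloor>) has_real_derivative - 1 / x\<^sup>2 - 0) (at x)"
    by (intro DERIV_diff)
  moreover have "gauss_map = (\<lambda>x. 1 / x - real_of_int \<lfloor>1 / x\<rfloor>)"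
    by (auto simp: gauss_map_def frac_def)
  ultimately show ?thesis by simp
qed

definition cf_weight :: "nat \<Rightarrow> real \<Rightarrow> real" where
  "cf_weight n x = (\<Prod>k<n. 1 / (gauss_map ^^ k) x)"

lemma abs_deriv_gauss_map_iterate:
  assumes "x \<in> {0..<1}" "x \<notin> \<rat>"
  shows "\<bar>deriv (gauss_map ^^ n) x\<bar> = (cf_weight n x)\<^sup>2"
proof -
  have "((gauss_map ^^ n) has_real_derivative (\<Prod>k<n. - 1 / ((gauss_map ^^ k) x)\<^sup>2)) (at x)"
  proof (induction n)
    case (Suc n)
    then show ?case
      using DERIV_chain[OF gauss_map_has_derivative Suc] gauss_map_iterate_irrational[OF assms, of n]
      by (simp add: mult.commute comp_def)
  qed (simp add: id_def)
  then have "deriv (gauss_map ^^ n) x = (\<Prod>k<n. - 1 / ((gauss_map ^^ k) x)\<^sup>2)"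
    by (rule DERIV_imp_deriv)
  then show ?thesis
    by (simp add: cf_weight_def abs_prod power_divide prod_power_distrib)
qed

section \<open>Cylinders\<close>

text \<open>Shifted by one: \<open>cf_denom a (Suc n)\<close> is the usual \<open>q\<^sub>n\<close>, with \<open>q\<^sub>-\<^sub>1 = 0\<close> at index \<open>0\<close>, and
  \<open>a n\<close> stands for the partial quotient \<open>a\<^sub>n\<^sub>+\<^sub>1\<close>.\<close>

fun cf_denom :: "(nat \<Rightarrow> int) \<Rightarrow> nat \<Rightarrow> real" where
  "cf_denom a 0 = 0"
| "cf_denom a (Suc 0) = 1"
| "cf_denom a (Suc (Suc n)) = of_int (a n) * cf_denom a (Suc n) + cf_denom a n"

text \<open>The inverse branch of the \<open>n\<close>-th iterate of the Gauss map.\<close>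

primrec cf_branch :: "(nat \<Rightarrow> int) \<Rightarrow> nat \<Rightarrow> real \<Rightarrow> real" where
  "cf_branch a 0 u = u"
| "cf_branch a (Suc n) u = cf_branch a n (1 / (of_int (a n) + u))"

lemma cf_denom_pos_mono:
  assumes "\<And>k. a k \<ge> 1"
  shows "0 \<le> cf_denom a n \<and> 0 < cf_denom a (Suc n) \<and> cf_denom a n \<le> cf_denom a (Suc n)"
proof (induction n)
  case (Suc n)
  have "1 * cf_denom a (Suc n) \<le> of_int (a n) * cf_denom a (Suc n)"
    using Suc assms[of n] by (intro mult_right_mono) auto
  then show ?case using Suc by (simp add: add_pos_nonneg add_increasing2)
qed simp

lemma cf_branch_diff:
  assumes "\<And>k. a k \<ge> 1" "0 \<le> u" "0 \<le> v"
  shows "cf_branch a n u - cf_branch a n v =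
    (-1) ^ n * (u - v) /
      ((cf_denom a (Suc n) + cf_denom a n * u) * (cf_denom a (Suc n) + cf_denom a n * v))"
  using assms(2,3)
proof (induction n arbitrary: u v)
  case (Suc n)
  define b where "b = real_of_int (a n)"
  have b: "b \<ge> 1" using assms(1)[of n] by (simp add: b_def)
  let ?q = "cf_denom a (Suc n)" and ?q' = "cf_denom a n"
  have q: "0 \<le> ?q'" "0 < ?q" using cf_denom_pos_mono[OF assms(1)] by auto
  have pos: "b + u > 0" "b + v > 0" using b Suc.prems by auto
  have rew: "(?q + ?q' * (1 / (b + w))) = (?q * (b + w) + ?q') / (b + w)" if "b + w > 0" for w
    using that by (simp add: field_simps)
  have pos': "?q * (b + u) + ?q' > 0" "?q * (b + v) + ?q' > 0"
    using q pos by (auto intro!: add_pos_nonneg)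
  have "cf_branch a (Suc n) u - cf_branch a (Suc n) v =
    (-1) ^ n * (1 / (b + u) - 1 / (b + v)) /
      ((?q + ?q' * (1 / (b + u))) * (?q + ?q' * (1 / (b + v))))"
    using pos unfolding cf_branch.simps b_def[symmetric] by (intro Suc.IH) auto
  also have "\<dots> = (-1) ^ n * (v - u) / ((?q * (b + u) + ?q') * (?q * (b + v) + ?q'))"
    unfolding rew[OF pos(1)] rew[OF pos(2)] using pos pos' by (simp add: divide_simps)
  finally show ?case
    by (simp add: b_def algebra_simps)
qed simp

lemma continuous_on_cf_branch:
  assumes "\<And>k. a k \<ge> 1"
  shows "continuous_on {0..} (cf_branch a n)"
proof (induction n)
  case (Suc n)
  have a: "real_of_int (a n) \<ge> 1" using assms[of n] by simp
  have "continuous_on {0..} (\<lambda>u. 1 / (real_of_int (a n) + u))"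
    using a by (intro continuous_intros) auto
  then show ?case
    unfolding cf_branch.simps using a
    by (intro continuous_on_compose2[OF Suc]) auto
qed simp

lemma cf_branch_in_cylinder:
  assumes "\<And>k. a k \<ge> 1" "0 < u" "u < 1"
  shows "cf_branch a n u \<in> {0<..<1} \<and> (gauss_map ^^ n) (cf_branch a n u) = u \<and>
    (\<forall>j<n. partial_quotient (Suc j) (cf_branch a n u) = a j)"
  using assms(2,3)
proof (induction n arbitrary: u)
  case (Suc n)
  define v where "v = 1 / (of_int (a n) + u)"
  have a: "real_of_int (a n) \<ge> 1" using assms(1)[of n] by simp
  have v: "0 < v" "v < 1" using a Suc.prems by (auto simp: v_def)
  have inv: "1 / v = of_int (a n) + u" using a Suc.prems by (simp add: v_def)
  have fl: "\<lfloor>of_int (a n) + u\<rfloor> = a n" using Suc.prems by linarith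
  have "gauss_map v = u" using Suc.prems fl by (simp add: gauss_map_def inv frac_def)
  with Suc.IH[OF v] fl inv show ?case
    by (auto simp: v_def[symmetric] partial_quotient_def less_Suc_eq)
qed simp

lemma cf_branch_gauss_map_iterate:
  assumes "\<And>k. a k \<ge> 1" "\<And>j. j < n \<Longrightarrow> partial_quotient (Suc j) y = a j"
  shows "cf_branch a n ((gauss_map ^^ n) y) = y"
  using assms(2)
proof (induction n)
  case (Suc n)
  let ?z = "(gauss_map ^^ n) y"
  have "\<lfloor>1 / ?z\<rfloor> = a n" using Suc.prems[of n] by (simp add: partial_quotient_def)
  then have "1 / ?z = of_int (a n) + gauss_map ?z"
    using inverse_eq_floor_plus_gauss_map[of ?z] by simp
  then have "1 / (of_int (a n) + (gauss_map ^^ Suc n) y) = ?z"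
    by (metis comp_apply div_by_1 divide_divide_eq_right funpow.simps(2) mult_1)
  then show ?case using Suc by simp
qed simp


lemma partial_quotient_ge_1:
  assumes "x \<in> {0..<1}" "x \<notin> \<rat>"
  shows "partial_quotient n x \<ge> 1"
proof -
  have "1 \<le> 1 / (gauss_map ^^ (n - 1)) x"
    using gauss_map_iterate_irrational[OF assms, of "n - 1"] by (simp add: divide_simps)
  then show ?thesis by (simp add: partial_quotient_def le_floor_iff)
qed

lemma gauss_map_iterate_Suc:
  "1 / (gauss_map ^^ n) x = partial_quotient (Suc n) x + (gauss_map ^^ Suc n) x"
  using inverse_eq_floor_plus_gauss_map[of "(gauss_map ^^ n) x"] by (simp add: partial_quotient_def)

lemma gauss_map_iterate_mult_le:
  assumes "x \<in> {0..<1}" "x \<notin> \<rat>"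
  shows "(gauss_map ^^ n) x * (gauss_map ^^ Suc n) x \<le> 1 - (gauss_map ^^ n) x"
proof -
  let ?t = "(gauss_map ^^ n) x" and ?a = "real_of_int (partial_quotient (Suc n) x)"
  have t: "0 < ?t" using gauss_map_iterate_irrational[OF assms] by blast
  have "?t * (?a + (gauss_map ^^ Suc n) x) = 1"
    unfolding gauss_map_iterate_Suc[symmetric] using t by simp
  moreover have "?t * 1 \<le> ?t * ?a"
    using t partial_quotient_ge_1[OF assms, of "Suc n"] by (intro mult_left_mono) auto
  ultimately show ?thesis by (simp add: algebra_simps)
qed

lemma cf_weight_pos:
  assumes "x \<in> {0..<1}" "x \<notin> \<rat>"
  shows "cf_weight n x > 0"
  unfolding cf_weight_def using gauss_map_iterate_irrational[OF assms] by (intro prod_pos) auto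

lemma cf_weight_Suc: "cf_weight (Suc n) x = cf_weight n x / (gauss_map ^^ n) x"
  by (simp add: cf_weight_def)

lemma cf_weight_double:
  assumes "x \<in> {0..<1}" "x \<notin> \<rat>"
  shows "2 * cf_weight n x \<le> cf_weight (Suc (Suc n)) x"
proof -
  let ?t = "(gauss_map ^^ n) x" and ?t' = "(gauss_map ^^ Suc n) x"
  have t: "0 < ?t" "?t < 1" "0 < ?t'" "?t' < 1"
    using gauss_map_iterate_irrational[OF assms] by blast+
  have "?t * ?t' \<le> ?t" using t by (simp add: mult_le_cancel_left1)
  then have "?t * ?t' * 2 \<le> 1" using gauss_map_iterate_mult_le[OF assms, of n] by simp
  then have "cf_weight n x * (?t * ?t' * 2) \<le> cf_weight n x * 1"
    using cf_weight_pos[OF assms, of n] by (intro mult_left_mono) auto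
  moreover have "cf_weight (Suc (Suc n)) x = cf_weight n x / (?t * ?t')"
    by (simp only: cf_weight_Suc divide_divide_eq_left)
  ultimately show ?thesis using t by (simp add: pos_le_divide_eq algebra_simps)
qed

lemma cf_weight_lower_bound:
  assumes "x \<in> {0..<1}" "x \<notin> \<rat>"
  shows "2 powr ((real n - 1) / 2) \<le> cf_weight n x"
proof (induction n rule: nat_induct2)
  case 0
  show ?case by (simp add: cf_weight_def powr_minus_divide divide_le_eq ge_one_powr_ge_zero)
next
  case 1
  show ?case
    using gauss_map_iterate_irrational[OF assms, of 0] by (simp add: cf_weight_def)
next
  case (step n)
  have "(2::real) powr ((real (n + 2) - 1) / 2) = 2 * 2 powr ((real n - 1) / 2)"
    by (simp add: powr_mult_base field_simps)
  then show ?case using step cf_weight_double[OF assms, of n] by simp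
qed

lemma cf_weight_eq_denom:
  assumes "x \<in> {0..<1}" "x \<notin> \<rat>"
  defines "a \<equiv> \<lambda>n. partial_quotient (Suc n) x"
  shows "cf_weight n x = cf_denom a (Suc n) + cf_denom a n * (gauss_map ^^ n) x"
proof (induction n)
  case (Suc n)
  let ?t = "(gauss_map ^^ n) x"
  have t: "0 < ?t" using gauss_map_iterate_irrational[OF assms(1,2)] by blast
  have "cf_weight (Suc n) x = cf_denom a (Suc n) * (1 / ?t) + cf_denom a n"
    unfolding cf_weight_Suc Suc using t by (simp add: add_divide_distrib)
  then show ?case
    unfolding gauss_map_iterate_Suc by (simp add: a_def algebra_simps)
qed (simp add: cf_weight_def)

lemma cf_weight_denom_bounds:
  assumes "x \<in> {0..<1}" "x \<notin> \<rat>"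
  defines "a \<equiv> \<lambda>n. partial_quotient (Suc n) x"
  shows "0 < cf_denom a (Suc n)" "cf_denom a (Suc n) \<le> cf_weight n x"
    "cf_weight n x \<le> cf_denom a (Suc n) + cf_denom a n"
    "cf_denom a (Suc n) + cf_denom a n \<le> 2 * cf_denom a (Suc n)"
proof -
  have q: "0 \<le> cf_denom a n \<and> 0 < cf_denom a (Suc n) \<and> cf_denom a n \<le> cf_denom a (Suc n)"
    by (rule cf_denom_pos_mono) (simp add: a_def partial_quotient_ge_1[OF assms(1,2)])
  have t: "0 < (gauss_map ^^ n) x" "(gauss_map ^^ n) x < 1"
    using gauss_map_iterate_irrational[OF assms(1,2)] by blast+
  have w: "cf_weight n x = cf_denom a (Suc n) + cf_denom a n * (gauss_map ^^ n) x"
    unfolding a_def by (rule cf_weight_eq_denom[OF assms(1,2)])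
  show "0 < cf_denom a (Suc n)" "cf_denom a (Suc n) + cf_denom a n \<le> 2 * cf_denom a (Suc n)"
    using q by auto
  show "cf_denom a (Suc n) \<le> cf_weight n x" unfolding w using q t by simp
  show "cf_weight n x \<le> cf_denom a (Suc n) + cf_denom a n"
    unfolding w using q t by (simp add: mult_left_le)
qed

lemma cf_cylinder_between:
  fixes n :: nat
  assumes "x \<in> {0..<1}" "x \<notin> \<rat>"
  defines "b \<equiv> cf_branch (\<lambda>n. partial_quotient (Suc n) x) n"
  shows "open_segment (b 0) (b 1) \<subseteq> cf_cylinder n x"
    "cf_cylinder n x \<subseteq> closed_segment (b 0) (b 1)"
proof -
  define a where "a = (\<lambda>n. partial_quotient (Suc n) x)"
  have a: "\<And>k. a k \<ge> 1" by (simp add: a_def partial_quotient_ge_1[OF assms(1,2)])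
  have b: "b = cf_branch a n" by (simp add: b_def a_def)
  have cyl: "y \<in> cf_cylinder n x \<longleftrightarrow>
      y \<in> {0..<1} \<and> (\<forall>j<n. partial_quotient (Suc j) y = a j)" for y
    unfolding cf_cylinder_def a_def
    by (auto simp: Suc_le_eq dest!: Suc_le_D) (metis Suc_pred' less_le_trans less_Suc_eq_le not_less_eq zero_less_Suc Suc_le_eq)
  have cont: "continuous_on {0..1} b"
    unfolding b by (rule continuous_on_subset[OF continuous_on_cf_branch[OF a]]) auto
  show "open_segment (b 0) (b 1) \<subseteq> cf_cylinder n x"
  proof
    fix y assume y: "y \<in> open_segment (b 0) (b 1)"
    have "convex (b ` {0..1})"
      using connected_continuous_image[OF cont] by (simp add: connected_convex_1)
    then have "closed_segment (b 0) (b 1) \<subseteq> b ` {0..1}"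
      by (intro closed_segment_subset) auto
    then have "y \<in> b ` {0..1}" using y by (auto simp: open_segment_def)
    then obtain u where u: "u \<in> {0..1}" "y = b u" by auto
    with y have "u \<noteq> 0" "u \<noteq> 1" by (auto simp: open_segment_def)
    with u have "0 < u" "u < 1" by auto
    then show "y \<in> cf_cylinder n x"
      using cf_branch_in_cylinder[where a = a and u = u and n = n, OF a] u(2) by (auto simp: cyl b)
  qed
  show "cf_cylinder n x \<subseteq> closed_segment (b 0) (b 1)"
  proof
    fix y assume y: "y \<in> cf_cylinder n x"
    let ?u = "(gauss_map ^^ n) y"
    have yb: "y = b ?u"
      using y cf_branch_gauss_map_iterate[where a = a and n = n and y = y, OF a] by (simp add: cyl b)
    have "0 \<le> ?u \<and> ?u \<le> 1"
    proof (cases n)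
      case 0
      then show ?thesis using y by (auto simp: cf_cylinder_def)
    next
      case (Suc m)
      then show ?thesis by (simp add: gauss_map_def less_imp_le[OF frac_lt_1])
    qed
    then have u: "0 \<le> ?u" "?u \<le> 1" by auto
    have q: "0 \<le> cf_denom a n" "0 < cf_denom a (Suc n)" using cf_denom_pos_mono[OF a] by auto
    have D: "cf_denom a (Suc n) + cf_denom a n * v > 0" if "v \<ge> 0" for v
      using q that by (auto intro: add_pos_nonneg)
    have d0: "b ?u - b 0 = (-1) ^ n * (?u /
        ((cf_denom a (Suc n) + cf_denom a n * ?u) * cf_denom a (Suc n)))"
      using cf_branch_diff[where a = a and u = ?u and v = 0 and n = n, OF a u(1)] by (simp add: b)
    have d1: "b 1 - b ?u = (-1) ^ n * ((1 - ?u) /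
        ((cf_denom a (Suc n) + cf_denom a n) * (cf_denom a (Suc n) + cf_denom a n * ?u)))"
      using cf_branch_diff[where a = a and u = 1 and v = ?u and n = n, OF a zero_le_one u(1)] by (simp add: b)
    have pos: "0 \<le> ?u / ((cf_denom a (Suc n) + cf_denom a n * ?u) * cf_denom a (Suc n))"
      "0 \<le> (1 - ?u) / ((cf_denom a (Suc n) + cf_denom a n) * (cf_denom a (Suc n) + cf_denom a n * ?u))"
      using u q D[OF u(1)] by auto
    show "y \<in> closed_segment (b 0) (b 1)"
    proof (cases "even n")
      case True
      then have "b 0 \<le> b ?u" "b ?u \<le> b 1" using d0 d1 pos by auto
      then show ?thesis using yb by (simp add: closed_segment_eq_real_ivl)
    next
      case False
      then have "(-1) ^ n = (-1::real)" by simp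
      then have "b 1 \<le> b ?u" "b ?u \<le> b 0"
        using d0 d1 pos by (simp_all only: mult_minus_left mult_1_left)
      then show ?thesis using yb by (simp add: closed_segment_eq_real_ivl)
    qed
  qed
qed

lemma sets_cf_cylinder:
  assumes "x \<in> {0..<1}" "x \<notin> \<rat>"
  shows "cf_cylinder n x \<in> sets borel"
proof -
  define b where "b = cf_branch (\<lambda>n. partial_quotient (Suc n) x) n"
  have "cf_cylinder n x = open_segment (b 0) (b 1) \<union> (cf_cylinder n x \<inter> {b 0, b 1})"
    using cf_cylinder_between[OF assms, of n] unfolding b_def[symmetric]
    by (auto simp: open_segment_def)
  moreover have "finite (cf_cylinder n x \<inter> {b 0, b 1})" by simp
  moreover have "open_segment (b 0) (b 1) \<in> sets borel"
    by (auto simp: open_segment_eq_real_ivl)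
  ultimately show ?thesis by (metis sets.Un borel_closed finite_imp_closed)
qed

lemma cf_cylinder_length_eq:
  fixes n :: nat
  assumes "x \<in> {0..<1}" "x \<notin> \<rat>"
  defines "b \<equiv> cf_branch (\<lambda>n. partial_quotient (Suc n) x) n"
  shows "cf_cylinder_length n x = \<bar>b 1 - b 0\<bar>"
proof (rule antisym)
  have [measurable]: "cf_cylinder n x \<in> sets borel" by (rule sets_cf_cylinder[OF assms(1,2)])
  have "emeasure lborel (closed_segment (b 0) (b 1)) < \<infinity>"
    by (auto simp: closed_segment_eq_real_ivl)
  then have fin: "closed_segment (b 0) (b 1) \<in> fmeasurable lborel"
    by (intro fmeasurableI) (auto simp: closed_segment_eq_real_ivl)
  have fin': "cf_cylinder n x \<in> fmeasurable lborel"
    using cf_cylinder_between(2)[OF assms(1,2), of n] unfolding b_def[symmetric]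
    by (intro fmeasurableI2[OF fin]) auto
  show "cf_cylinder_length n x \<le> \<bar>b 1 - b 0\<bar>"
    using measure_mono_fmeasurable[OF cf_cylinder_between(2)[OF assms(1,2), of n, folded b_def] _ fin]
    by (auto simp: cf_cylinder_length_def closed_segment_eq_real_ivl split: if_splits)
  have "open_segment (b 0) (b 1) \<in> sets lborel" by (auto simp: open_segment_eq_real_ivl)
  from measure_mono_fmeasurable[OF cf_cylinder_between(1)[OF assms(1,2), of n, folded b_def] this fin']
  show "\<bar>b 1 - b 0\<bar> \<le> cf_cylinder_length n x"
    by (auto simp: cf_cylinder_length_def open_segment_eq_real_ivl split: if_splits)
qed

lemma cf_cylinder_length_bounds:
  assumes "x \<in> {0..<1}" "x \<notin> \<rat>"
  shows "1 / (2 * (cf_weight n x)\<^sup>2) \<le> cf_cylinder_length n x"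
    "cf_cylinder_length n x \<le> 2 / (cf_weight n x)\<^sup>2"
proof -
  define a where "a = (\<lambda>n. partial_quotient (Suc n) x)"
  have a: "\<And>k. a k \<ge> 1" by (simp add: a_def partial_quotient_ge_1[OF assms])
  let ?q = "cf_denom a (Suc n)" and ?q' = "cf_denom a n" and ?w = "cf_weight n x"
  note bnd = cf_weight_denom_bounds[OF assms, of n, folded a_def]
  have w: "?w > 0" using cf_weight_pos[OF assms] .
  have q': "?q + ?q' > 0" using bnd by linarith
  have L: "cf_cylinder_length n x = 1 / ((?q + ?q') * ?q)"
    unfolding cf_cylinder_length_eq[OF assms] a_def[symmetric]
    using cf_branch_diff[where a = a and u = 1 and v = 0 and n = n, OF a] bnd(1) q' by (simp add: abs_mult abs_divide power_abs)
  have "(?q + ?q') * ?q \<le> (2 * ?w) * ?w" using bnd by (intro mult_mono) auto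
  then show "1 / (2 * ?w\<^sup>2) \<le> cf_cylinder_length n x"
    unfolding L using bnd(1) q' w by (intro divide_left_mono) (auto simp: power2_eq_square)
  have "?w * ?w \<le> (?q + ?q') * (2 * ?q)" using bnd w by (intro mult_mono) auto
  then have "2 / (2 * ((?q + ?q') * ?q)) \<le> 2 / ?w\<^sup>2"
    using w by (intro frac_le) (auto simp: power2_eq_square algebra_simps)
  then show "cf_cylinder_length n x \<le> 2 / ?w\<^sup>2" unfolding L by simp
qed

lemma self_in_cf_cylinder: "x \<in> {0..<1} \<Longrightarrow> x \<in> cf_cylinder n x"
  by (simp add: cf_cylinder_def)

lemma dist_cf_cylinder_le:
  assumes "x \<in> {0..<1}" "x \<notin> \<rat>" "y \<in> cf_cylinder n x"
  shows "dist x y \<le> cf_cylinder_length n x"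
proof -
  have "x \<in> cf_cylinder n x" by (rule self_in_cf_cylinder[OF assms(1)])
  with assms(3) cf_cylinder_between(2)[OF assms(1,2), of n] show ?thesis
    unfolding cf_cylinder_length_eq[OF assms(1,2)] dist_real_def closed_segment_eq_real_ivl
    by (smt (verit) atLeastAtMost_iff subsetD)
qed

text \<open>The distance to the second endpoint is controlled by \<open>1 - T\<^sup>n x \<ge> T\<^sup>n x * T\<^sup>n\<^sup>+\<^sup>1 x\<close>, and the
  right-hand side is the quotient of the weights of stages \<open>n\<close> and \<open>n + 2\<close>.\<close>

lemma ball_subset_cf_cylinder:
  assumes "x \<in> {0..<1}" "x \<notin> \<rat>"
  shows "ball x (1 / (2 * (cf_weight (Suc (Suc n)) x)\<^sup>2)) \<subseteq> cf_cylinder n x"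
proof -
  define a where "a = (\<lambda>n. partial_quotient (Suc n) x)"
  have a: "\<And>k. a k \<ge> 1" by (simp add: a_def partial_quotient_ge_1[OF assms])
  let ?q = "cf_denom a (Suc n)" and ?q' = "cf_denom a n" and ?w = "cf_weight n x"
  let ?w2 = "cf_weight (Suc (Suc n)) x"
  let ?t = "(gauss_map ^^ n) x" and ?t' = "(gauss_map ^^ Suc n) x"
  define b where "b = cf_branch a n"
  define r where "r = 1 / (2 * ?w2\<^sup>2)"
  note bnd = cf_weight_denom_bounds[OF assms, of n, folded a_def]
  have w: "?w > 0" "?w2 > 0" using cf_weight_pos[OF assms] by auto
  have t: "0 < ?t" "?t < 1" "0 < ?t'" "?t' < 1"
    using gauss_map_iterate_irrational[OF assms] by blast+
  have tt: "?t * ?t' = ?w / ?w2"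
    using t w by (simp add: cf_weight_Suc)
  have w_le: "?w \<le> ?w2" using cf_weight_double[OF assms, of n] w by linarith
  have weq: "?q + ?q' * ?t = ?w" using cf_weight_eq_denom[OF assms, of n] by (simp add: a_def)
  have xb: "b ?t = x"
    unfolding b_def by (rule cf_branch_gauss_map_iterate[OF a]) (simp add: a_def)
  have r_le: "r \<le> (?t * ?t') / (2 * ?w\<^sup>2)"
  proof -
    have "2 * (?w * ?w2) \<le> 2 * ?w2\<^sup>2"
      using w w_le by (simp add: power2_eq_square)
    then have "r \<le> 1 / (2 * (?w * ?w2))"
      unfolding r_def using w by (intro divide_left_mono) auto
    also have "\<dots> = (?t * ?t') / (2 * ?w\<^sup>2)"
      unfolding tt using w by (simp add: power2_eq_square)
    finally show ?thesis .
  qed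
  have s1: "r \<le> ?t / (?w * ?q)"
  proof -
    have "?t * ?t' \<le> ?t" using t by (simp add: mult_le_cancel_left1)
    moreover have "?w * ?q \<le> 2 * ?w\<^sup>2" using bnd w by (simp add: power2_eq_square mult_left_mono)
    ultimately have "(?t * ?t') / (2 * ?w\<^sup>2) \<le> ?t / (?w * ?q)"
      using t w bnd(1) by (intro frac_le) auto
    then show ?thesis using r_le by simp
  qed
  have s2: "r \<le> (1 - ?t) / ((?q + ?q') * ?w)"
  proof -
    have "(?q + ?q') * ?w \<le> (2 * ?w) * ?w" using bnd w by (intro mult_right_mono) auto
    then have "(?t * ?t') / (2 * ?w\<^sup>2) \<le> (1 - ?t) / ((?q + ?q') * ?w)"
      using t w bnd(1,3) gauss_map_iterate_mult_le[OF assms, of n]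
      by (intro frac_le) (auto simp: power2_eq_square)
    then show ?thesis using r_le by simp
  qed
  have d0: "x - b 0 = (-1) ^ n * (?t / (?w * ?q))"
    using cf_branch_diff[where a = a and u = ?t and v = 0 and n = n, OF a] t unfolding b_def[symmetric] xb weq by simp
  have d1: "b 1 - x = (-1) ^ n * ((1 - ?t) / ((?q + ?q') * ?w))"
    using cf_branch_diff[where a = a and u = 1 and v = ?t and n = n, OF a] t unfolding b_def[symmetric] xb weq by simp
  have "ball x r \<subseteq> open_segment (b 0) (b 1)"
  proof
    fix y assume "y \<in> ball x r"
    then have y: "x - r < y" "y < x + r" by (auto simp: dist_real_def abs_if split: if_splits)
    show "y \<in> open_segment (b 0) (b 1)"
    proof (cases "even n")
      case True
      then have "b 0 < y" "y < b 1" using d0 d1 s1 s2 y by simp_all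
      then show ?thesis by (simp add: open_segment_eq_real_ivl)
    next
      case False
      then have "(-1) ^ n = (-1::real)" by simp
      then have "x - b 0 = - (?t / (?w * ?q))" "b 1 - x = - ((1 - ?t) / ((?q + ?q') * ?w))"
        using d0 d1 by (simp_all only: mult_minus_left mult_1_left)
      then have "b 1 < y" "y < b 0" using s1 s2 y by linarith+
      then show ?thesis by (simp add: open_segment_eq_real_ivl)
    qed
  qed
  with cf_cylinder_between(1)[OF assms, of n] show ?thesis
    unfolding a_def[symmetric] b_def[symmetric] r_def by blast
qed


section \<open>Logarithmic quotients\<close>

lemma log_ext_mono: "0 \<le> a \<Longrightarrow> a \<le> b \<Longrightarrow> log_ext a \<le> log_ext b"
  by (auto simp: log_ext_def)

lemma ereal_divide_right_antimono_neg:
  fixes u v :: ereal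
  assumes "u \<le> v" "c < 0"
  shows "v / ereal c \<le> u / ereal c"
proof -
  have "u / ereal (- c) \<le> v / ereal (- c)"
    using assms by (intro ereal_divide_right_mono) auto
  moreover have "z / ereal (- c) = - (z / ereal c)" for z
    using assms(2) by (cases z) auto
  ultimately show ?thesis by simp
qed

lemma ereal_divide_rescale:
  fixes u :: ereal
  assumes "c < 0" "d < 0"
  shows "u / ereal d = u / ereal c * ereal (c / d)"
  using assms by (cases u) (auto simp: zero_less_divide_iff)

lemma tendsto_div_shift:
  fixes f :: "nat \<Rightarrow> real"
  assumes "(\<lambda>n. f n / real n) \<longlonglongrightarrow> l"
  shows "(\<lambda>n. (f (n - k) + c) / real n) \<longlonglongrightarrow> l"
proof (rule LIMSEQ_offset[where k = k])
  have shift: "(\<lambda>n. b / real (n + k)) \<longlonglongrightarrow> 0" for b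
    by (rule LIMSEQ_ignore_initial_segment[OF lim_const_over_n])
  have "(\<lambda>n. f n / real n - f n / real n * (real k / real (n + k)) + c / real (n + k))
      \<longlonglongrightarrow> l - l * 0 + 0"
    by (intro tendsto_intros assms shift)
  then have "(\<lambda>n. f n / real n - f n / real n * (real k / real (n + k)) + c / real (n + k)) \<longlonglongrightarrow> l"
    by simp
  moreover have "\<forall>\<^sub>F n in sequentially.
      f n / real n - f n / real n * (real k / real (n + k)) + c / real (n + k)
        = (f (n + k - k) + c) / real (n + k)"
    using eventually_gt_at_top[of 0]
  proof eventually_elim
    case (elim n)
    then have "f n / real n - f n / real n * (real k / real (n + k)) = f n / real (n + k)"
      by (simp add: divide_simps) (simp add: algebra_simps)
    then show ?case by (simp add: add_divide_distrib)
  qed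
  ultimately show "(\<lambda>n. (f (n + k - k) + c) / real (n + k)) \<longlonglongrightarrow> l"
    by (rule Lim_transform_eventually)
qed

text \<open>For \<open>r\<close> small let \<open>N\<close> be the first stage with \<open>3 * e N \<le> r\<close>.  Then \<open>g r\<close> lies between
  \<open>m N\<close> and \<open>m (N - 7)\<close>, and as \<open>ln (e n)\<close> is asymptotically linear, \<open>ln r\<close> is equivalent to both
  \<open>ln (L N)\<close> and \<open>ln (L (N - 7))\<close>.\<close>

lemma tendsto_log_quotient_interpolate:
  fixes g :: "real \<Rightarrow> real" and m e L :: "nat \<Rightarrow> real" and l :: real
  assumes e: "\<And>n. 0 < e n" "decseq e" "\<And>n. e (Suc (Suc n)) \<le> e n / 4"
    and lin: "(\<lambda>n. ln (e n) / real n) \<longlonglongrightarrow> - l" "l > 0"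
    and L: "\<And>n. e n / 2 \<le> L n" "\<And>n. L n \<le> 2 * e n"
    and g: "\<And>r. 0 \<le> g r" "mono g"
    and m: "\<And>n. 0 \<le> m n" "\<And>n. g (e (Suc (Suc n)) / 2) \<le> m n" "\<And>n. m n \<le> g (3 * e n)"
    and lim: "(\<lambda>n. log_ext (m n) / ereal (ln (L n))) \<longlonglongrightarrow> d"
  shows "((\<lambda>r. log_ext (g r) / ereal (ln r)) \<longlongrightarrow> d) (at_right 0)"
proof -
  define N where "N r = (LEAST n. 3 * e n \<le> r)" for r
  have Lpos: "0 < L n" for n using L(1)[of n] e(1)[of n] by linarith
  have "filterlim (\<lambda>n. ln (e n) / real n * real n) at_bot sequentially"
    using lin by (intro filterlim_tendsto_neg_mult_at_bot[OF lin(1)] filterlim_real_sequentially) auto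
  moreover have "\<forall>\<^sub>F n in sequentially. ln (e n) / real n * real n = ln (e n)"
    using eventually_gt_at_top[of 0] by eventually_elim simp
  ultimately have lnbot: "filterlim (\<lambda>n. ln (e n)) at_bot sequentially"
    by (simp cong: filterlim_cong)
  then have "(\<lambda>n. exp (ln (e n))) \<longlonglongrightarrow> 0"
    by (rule filterlim_compose[OF exp_at_bot])
  then have e0: "e \<longlonglongrightarrow> 0" using e(1) by simp
  have N_le: "3 * e (N r) \<le> r" if "r > 0" for r
  proof -
    have "\<forall>\<^sub>F n in sequentially. e n < r / 3"
      using e0 that by (intro order_tendstoD) auto
    then obtain n where "e n < r / 3" using eventually_happens'[OF sequentially_bot] by blast
    then have "3 * e n \<le> r" by simp
    then show ?thesis unfolding N_def by (rule LeastI)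
  qed
  have N_ge: "r < 3 * e (N r - 1)" if "N r > 0" for r
  proof -
    have "N r - 1 < N r" using that by simp
    then have "\<not> 3 * e (N r - 1) \<le> r" unfolding N_def by (rule not_less_Least)
    then show ?thesis by simp
  qed
  have N_top: "filterlim N at_top (at_right 0)"
    unfolding filterlim_at_top
  proof
    fix K
    have "\<forall>\<^sub>F r in at_right 0. r \<in> {0<..<3 * e K}"
      using e(1) by (intro eventually_at_right_real) auto
    then show "\<forall>\<^sub>F r in at_right 0. K \<le> N r"
    proof eventually_elim
      case (elim r)
      show ?case
      proof (rule ccontr)
        assume "\<not> K \<le> N r"
        then have "e K \<le> e (N r)" using e(2) by (simp add: decseq_def)
        then show False using N_le[of r] elim by auto
      qed
    qed
  qed
  have ev: "\<forall>\<^sub>F r in at_right 0. r \<in> {0<..<1} \<and> N r \<ge> 7 \<and> ln (L (N r)) < 0 \<and> ln (L (N r - 7)) < 0"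
  proof -
    have "\<forall>\<^sub>F n in sequentially. e n < 1 / 2" using e0 by (intro order_tendstoD) auto
    then obtain n0 where n0: "\<And>n. n \<ge> n0 \<Longrightarrow> e n < 1 / 2"
      by (auto simp: eventually_sequentially)
    have neg: "ln (L n) < 0" if "n \<ge> n0" for n
      using L(2)[of n] n0[OF that] Lpos[of n] by (simp add: ln_less_zero)
    have "\<forall>\<^sub>F r in at_right 0. n0 + 7 \<le> N r"
      using N_top by (simp add: filterlim_at_top)
    moreover have "\<forall>\<^sub>F r in at_right (0::real). r \<in> {0<..<1}"
      by (intro eventually_at_right_real) auto
    ultimately show ?thesis
      by eventually_elim (auto intro!: neg)
  qed
  have lnL: "(\<lambda>n. ln (L (n - k)) / real n) \<longlonglongrightarrow> - l" for k
  proof (rule tendsto_sandwich)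
    show "(\<lambda>n. (ln (e (n - k)) + - ln 2) / real n) \<longlonglongrightarrow> - l"
      "(\<lambda>n. (ln (e (n - k)) + ln 2) / real n) \<longlonglongrightarrow> - l"
      by (rule tendsto_div_shift[OF lin(1)])+
    have "ln (e n) + - ln 2 \<le> ln (L n)" for n
    proof -
      have "ln (e n / 2) \<le> ln (L n)" using L(1)[of n] e(1)[of n] Lpos[of n] by simp
      then show ?thesis using e(1)[of n] by (simp add: ln_div)
    qed
    then show "\<forall>\<^sub>F n in sequentially. (ln (e (n - k)) + - ln 2) / real n \<le> ln (L (n - k)) / real n"
      by (intro always_eventually allI divide_right_mono) auto
    have "ln (L n) \<le> ln (e n) + ln 2" for n
    proof -
      have "ln (L n) \<le> ln (2 * e n)" using L(2)[of n] e(1)[of n] Lpos[of n] by simp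
      then show ?thesis using e(1)[of n] by (simp add: ln_mult)
    qed
    then show "\<forall>\<^sub>F n in sequentially. ln (L (n - k)) / real n \<le> (ln (e (n - k)) + ln 2) / real n"
      by (intro always_eventually allI divide_right_mono) auto
  qed
  have lnr: "((\<lambda>r. ln r / real (N r)) \<longlongrightarrow> - l) (at_right 0)"
  proof (rule tendsto_sandwich)
    show "((\<lambda>r. (ln (e (N r - 0)) + ln 3) / real (N r)) \<longlongrightarrow> - l) (at_right 0)"
      "((\<lambda>r. (ln (e (N r - 1)) + ln 3) / real (N r)) \<longlongrightarrow> - l) (at_right 0)"
      by (rule filterlim_compose[OF tendsto_div_shift[OF lin(1)] N_top])+
    show "\<forall>\<^sub>F r in at_right 0. (ln (e (N r - 0)) + ln 3) / real (N r) \<le> ln r / real (N r)"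
      using ev
    proof eventually_elim
      case (elim r)
      then have "ln (3 * e (N r)) \<le> ln r" using N_le[of r] e(1)[of "N r"] by simp
      then show ?case using e(1)[of "N r"] by (intro divide_right_mono) (auto simp: ln_mult)
    qed
    show "\<forall>\<^sub>F r in at_right 0. ln r / real (N r) \<le> (ln (e (N r - 1)) + ln 3) / real (N r)"
      using ev
    proof eventually_elim
      case (elim r)
      then have "ln r \<le> ln (3 * e (N r - 1))" using N_ge[of r] e(1)[of "N r - 1"] by simp
      then show ?case using e(1)[of "N r - 1"] by (intro divide_right_mono) (auto simp: ln_mult)
    qed
  qed
  have ratio: "((\<lambda>r. ereal (ln (L (N r - k)) / ln r)) \<longlongrightarrow> ereal 1) (at_right 0)" for k
  proof (rule tendsto_ereal)
    have "((\<lambda>r. (ln (L (N r - k)) / real (N r)) / (ln r / real (N r))) \<longlongrightarrow> - l / - l) (at_right 0)"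
      using lin(2) by (intro tendsto_divide lnr filterlim_compose[OF lnL N_top]) auto
    moreover have "\<forall>\<^sub>F r in at_right 0.
        (ln (L (N r - k)) / real (N r)) / (ln r / real (N r)) = ln (L (N r - k)) / ln r"
      using ev by eventually_elim auto
    ultimately show "((\<lambda>r. ln (L (N r - k)) / ln r) \<longlongrightarrow> 1) (at_right 0)"
      using lin(2) by (simp add: Lim_transform_eventually)
  qed
  have N7: "filterlim (\<lambda>r. N r - k) at_top (at_right 0)" for k
    by (rule filterlim_compose[OF filterlim_minus_const_nat_at_top N_top])
  have bound: "((\<lambda>r. log_ext (m (N r - k)) / ereal (ln (L (N r - k))) * ereal (ln (L (N r - k)) / ln r))
      \<longlongrightarrow> d) (at_right 0)" for k
  proof -
    have "((\<lambda>r. log_ext (m (N r - k)) / ereal (ln (L (N r - k))) * ereal (ln (L (N r - k)) / ln r))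
        \<longlongrightarrow> d * ereal 1) (at_right 0)"
      by (intro tendsto_mult_ereal ratio filterlim_compose[OF lim N7]) auto
    then show ?thesis by simp
  qed
  show ?thesis
  proof (rule tendsto_sandwich[OF _ _ bound[of 7] bound[of 0]])
    show "\<forall>\<^sub>F r in at_right 0. log_ext (m (N r - 7)) / ereal (ln (L (N r - 7))) *
        ereal (ln (L (N r - 7)) / ln r) \<le> log_ext (g r) / ereal (ln r)"
      using ev
    proof eventually_elim
      case (elim r)
      define k where "k = N r - 7"
      then have k: "N r - 1 = Suc (Suc (Suc (Suc (Suc (Suc k)))))" using elim by auto
      have "r < 3 * e (Suc (Suc (Suc (Suc (Suc (Suc k))))))" using N_ge[of r] elim k by simp
      also have "\<dots> \<le> e (Suc (Suc k)) / 2"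
        using e(3)[of "Suc (Suc (Suc (Suc k)))"] e(3)[of "Suc (Suc k)"] e(1)[of "Suc (Suc k)"] by linarith
      finally have "g r \<le> m k" using monoD[OF g(2), of r] m(2)[of k] by (meson less_imp_le order_trans)
      then have "log_ext (m k) / ereal (ln r) \<le> log_ext (g r) / ereal (ln r)"
        using elim g(1) by (intro ereal_divide_right_antimono_neg log_ext_mono) auto
      then show ?case
        using elim ereal_divide_rescale[of "ln (L k)" "ln r" "log_ext (m k)"] by (simp add: k_def)
    qed
    show "\<forall>\<^sub>F r in at_right 0. log_ext (g r) / ereal (ln r) \<le>
        log_ext (m (N r - 0)) / ereal (ln (L (N r - 0))) * ereal (ln (L (N r - 0)) / ln r)"
      using ev
    proof eventually_elim
      case (elim r)
      have "m (N r) \<le> g r" using m(3)[of "N r"] monoD[OF g(2) N_le[of r]] elim by auto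
      then have "log_ext (g r) / ereal (ln r) \<le> log_ext (m (N r)) / ereal (ln r)"
        using elim m(1) by (intro ereal_divide_right_antimono_neg log_ext_mono) auto
      then show ?case
        using elim ereal_divide_rescale[of "ln (L (N r))" "ln r" "log_ext (m (N r))"] by simp
    qed
  qed
qed

lemma tendsto_log_quotient_comparable:
  fixes u v L :: "nat \<Rightarrow> real"
  assumes "comparable u v" "\<And>n. 0 \<le> v n" "\<And>n. 0 < L n" "L \<longlonglongrightarrow> 0"
    and lim: "(\<lambda>n. log_ext (u n) / ereal (ln (L n))) \<longlonglongrightarrow> d"
  shows "(\<lambda>n. log_ext (v n) / ereal (ln (L n))) \<longlonglongrightarrow> d"
proof -
  obtain c1 c2 where c: "c1 > 0" "c2 > 0"
    and ev: "\<forall>\<^sub>F n in sequentially. c1 * v n \<le> u n \<and> u n \<le> c2 * v n"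
    using assms(1) unfolding comparable_def by blast
  define h where "h n = (if v n = 0 then 0 else ln (v n) - ln (u n))" for n
  define C where "C = \<bar>ln c1\<bar> + \<bar>ln c2\<bar>"
  have "filterlim L (at_right 0) sequentially"
    using assms(3,4) by (intro tendsto_imp_filterlim_at_right) auto
  then have lnL: "filterlim (\<lambda>n. ln (L n)) at_bot sequentially"
    by (rule filterlim_compose[OF ln_at_0])
  have hb: "\<forall>\<^sub>F n in sequentially. \<bar>h n\<bar> \<le> C"
    using ev
  proof eventually_elim
    case (elim n)
    show ?case
    proof (cases "v n = 0")
      case False
      then have v: "v n > 0" using assms(2)[of n] by simp
      then have "0 < c1 * v n" using c by simp
      then have u: "u n > 0" using elim by linarith
      have "ln (c1 * v n) \<le> ln (u n)" "ln (u n) \<le> ln (c2 * v n)"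
        using elim c u v by simp_all
      then show ?thesis using c v by (simp add: h_def C_def ln_mult)
    qed (simp add: h_def C_def)
  qed
  have "(\<lambda>n. h n / ln (L n)) \<longlonglongrightarrow> 0"
  proof (rule Lim_null_comparison)
    have "\<forall>\<^sub>F n in sequentially. ln (L n) < 0"
      using lnL by (auto simp: filterlim_at_bot_dense)
    then show "\<forall>\<^sub>F n in sequentially. norm (h n / ln (L n)) \<le> - C / ln (L n)"
      using hb by eventually_elim (simp add: abs_divide divide_simps)
    show "(\<lambda>n. - C / ln (L n)) \<longlonglongrightarrow> 0"
      by (rule tendsto_divide_0[OF tendsto_const filterlim_at_bot_imp_at_infinity[OF lnL]])
  qed
  then have "(\<lambda>n. log_ext (u n) / ereal (ln (L n)) + ereal (h n / ln (L n))) \<longlonglongrightarrow> d + ereal 0"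
    by (intro tendsto_add_ereal_general lim) auto
  moreover have "\<forall>\<^sub>F n in sequentially. ln (L n) < 0"
    using lnL by (auto simp: filterlim_at_bot_dense)
  then have "\<forall>\<^sub>F n in sequentially.
      log_ext (u n) / ereal (ln (L n)) + ereal (h n / ln (L n)) = log_ext (v n) / ereal (ln (L n))"
    using ev
  proof eventually_elim
    case (elim n)
    show ?case
    proof (cases "v n = 0")
      case True
      then have "u n = 0" using elim by auto
      then show ?thesis using True by (simp add: h_def)
    next
      case False
      then have "0 < c1 * v n" using assms(2)[of n] c by simp
      then have "u n > 0" using elim by linarith
      then show ?thesis using False elim
        by (simp add: h_def log_ext_def flip: add_divide_distrib)
    qed
  qed
  ultimately show ?thesis by (simp add: Lim_transform_eventually)
qed

theorem lemma2p12:
  fixes M :: "real measure" and x :: real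
  assumes "prob_space M"
    and "sets M = sets (restrict_space borel {0..<1})"
    and "x \<in> {0..<1}"
    and "x \<notin> \<rat>"
  shows "(comparable (\<lambda>n. ball_measure M x (cf_cylinder_length n x))
            (\<lambda>n. measure M (cf_cylinder n x))
          \<longrightarrow> pointwise_dim_exists M x
          \<longrightarrow> markov_dim_exists M x \<and> markov_dim M x = pointwise_dim M x)
       \<and> (markov_dim_exists M x \<and> lyapunov_exists x
          \<longrightarrow> pointwise_dim_exists M x \<and> markov_dim M x = pointwise_dim M x)"
proof -
  interpret prob_space M by fact
  let ?L = "\<lambda>n. cf_cylinder_length n x" and ?w = "\<lambda>n. cf_weight n x"
  note x = assms(3,4)
  have space: "space M = {0..<1}"
    using sets_eq_imp_space_eq[OF assms(2)] by (simp add: space_restrict_space)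
  have w: "0 < ?w n" for n using cf_weight_pos[OF x] .
  note Lb = cf_cylinder_length_bounds[OF x]
  have Lpos: "0 < ?L n" for n
  proof -
    have "0 < 1 / (2 * (?w n)\<^sup>2)" using w[of n] by simp
    then show ?thesis using Lb(1)[of n] by linarith
  qed
  have L0: "?L \<longlonglongrightarrow> 0"
  proof (rule tendsto_sandwich[OF _ _ tendsto_const])
    show "\<forall>\<^sub>F n in sequentially. ?L n \<le> 2 / (2 powr ((real n - 1) / 2))\<^sup>2"
    proof (intro always_eventually allI)
      fix n
      have "2 / (?w n)\<^sup>2 \<le> 2 / (2 powr ((real n - 1) / 2))\<^sup>2"
        using cf_weight_lower_bound[OF x, of n] by (intro frac_le power_mono) auto
      then show "?L n \<le> 2 / (2 powr ((real n - 1) / 2))\<^sup>2" using Lb(2)[of n] by linarith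
    qed
    show "(\<lambda>n. 2 / (2 powr ((real n - 1) / 2))\<^sup>2 :: real) \<longlonglongrightarrow> 0" by real_asymp
    show "\<forall>\<^sub>F n in sequentially. 0 \<le> ?L n" by (intro always_eventually allI less_imp_le Lpos)
  qed
  have part_a: "markov_dim_exists M x \<and> markov_dim M x = pointwise_dim M x"
    if comp: "comparable (\<lambda>n. ball_measure M x (?L n)) (\<lambda>n. measure M (cf_cylinder n x))"
      and "pointwise_dim_exists M x"
  proof -
    from that obtain d where d: "(pointwise_quotient M x \<longlongrightarrow> d) (at_right 0)"
      by (auto simp: pointwise_dim_exists_def)
    have "filterlim ?L (at_right 0) sequentially"
      using Lpos L0 by (intro tendsto_imp_filterlim_at_right) auto
    from filterlim_compose[OF d this]
    have "(\<lambda>n. log_ext (ball_measure M x (?L n)) / ereal (ln (?L n))) \<longlonglongrightarrow> d"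
      by (simp add: pointwise_quotient_def)
    from tendsto_log_quotient_comparable[OF comp measure_nonneg Lpos L0 this]
    have "markov_quotient M x \<longlonglongrightarrow> d"
      by (simp add: markov_quotient_def[abs_def])
    then show ?thesis
      using limI[of "markov_quotient M x" d] tendsto_Lim[OF _ d]
      by (auto simp: markov_dim_exists_def markov_dim_def pointwise_dim_def)
  qed
  have part_b: "pointwise_dim_exists M x \<and> markov_dim M x = pointwise_dim M x"
    if A: "markov_dim_exists M x \<and> lyapunov_exists x"
  proof -
    from that obtain d where d: "markov_quotient M x \<longlonglongrightarrow> d" by (auto simp: markov_dim_exists_def)
    obtain l where l: "(\<lambda>n. 1 / real n * ln \<bar>deriv (gauss_map ^^ n) x\<bar>) \<longlonglongrightarrow> l"
      using A by (auto simp: lyapunov_exists_def convergent_def)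
    have ln_eq: "1 / real n * ln \<bar>deriv (gauss_map ^^ n) x\<bar> = 2 * ln (?w n) / real n" for n
      using w[of n] by (simp add: abs_deriv_gauss_map_iterate[OF x] ln_realpow)
    define e where "e n = 1 / (?w n)\<^sup>2" for n
    have "(\<lambda>n. (real n - 1) * ln 2 / real n) \<longlonglongrightarrow> ln 2" by real_asymp
    moreover have "(real n - 1) * ln 2 / real n \<le> 1 / real n * ln \<bar>deriv (gauss_map ^^ n) x\<bar>" for n
    proof -
      have "(real n - 1) / 2 * ln 2 = ln (2 powr ((real n - 1) / 2))" by (simp add: ln_powr)
      also have "\<dots> \<le> ln (?w n)"
        using cf_weight_lower_bound[OF x, of n] by (intro ln_mono) auto
      finally have "(real n - 1) * ln 2 \<le> 2 * ln (?w n)" by simp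
      then show ?thesis unfolding ln_eq by (intro divide_right_mono) auto
    qed
    ultimately have "ln 2 \<le> l"
      using LIMSEQ_le[OF _ l] by blast
    then have lpos: "l > 0" using ln_gt_zero[of "2::real"] by linarith
    have lin: "(\<lambda>n. ln (e n) / real n) \<longlonglongrightarrow> - l"
    proof -
      have "ln (e n) / real n = - (1 / real n * ln \<bar>deriv (gauss_map ^^ n) x\<bar>)" for n
        unfolding ln_eq using w[of n] by (simp add: e_def ln_div ln_realpow)
      then show ?thesis using tendsto_minus[OF l] by simp
    qed
    have epos: "0 < e n" for n using w[of n] by (simp add: e_def)
    have w_mono: "?w n \<le> ?w (Suc n)" for n
      using w[of n] gauss_map_iterate_irrational[OF x, of n]
      by (auto simp: cf_weight_Suc le_divide_eq mult_left_le)
    have edec: "decseq e"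
      unfolding decseq_Suc_iff e_def using w w_mono
      by (intro allI divide_left_mono power_mono mult_pos_pos zero_less_power) (auto intro: less_imp_le)
    have e4: "e (Suc (Suc n)) \<le> e n / 4" for n
    proof -
      have "(2 * ?w n)\<^sup>2 \<le> (?w (Suc (Suc n)))\<^sup>2"
        using cf_weight_double[OF x, of n] w[of n] by (intro power_mono) auto
      then have "1 / (?w (Suc (Suc n)))\<^sup>2 \<le> 1 / (2 * ?w n)\<^sup>2"
        using w[of n] by (intro frac_le) auto
      then show ?thesis by (simp add: e_def power_mult_distrib)
    qed
    have sets: "S \<inter> {0..<1} \<in> sets M" if "S \<in> sets borel" for S
      using that unfolding assms(2) by (subst sets_restrict_space_iff) auto
    have cyl_sub: "cf_cylinder n x \<subseteq> {0..<1}" for n by (auto simp: cf_cylinder_def)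
    have cyl_sets: "cf_cylinder n x \<in> sets M" for n
      using sets[OF sets_cf_cylinder[OF x, of n]] cyl_sub[of n] by (simp add: inf.absorb1)
    have ball_sets: "ball x r \<inter> space M \<in> sets M" for r
      unfolding space by (rule sets) simp
    have "((\<lambda>r. log_ext (ball_measure M x r) / ereal (ln r)) \<longlongrightarrow> d) (at_right 0)"
    proof (rule tendsto_log_quotient_interpolate[OF epos edec e4 lin lpos])
      show "e n / 2 \<le> ?L n" "?L n \<le> 2 * e n" for n using Lb[of n] by (simp_all add: e_def)
      show "0 \<le> ball_measure M x r" for r by (simp add: ball_measure_def)
      show "mono (ball_measure M x)"
        unfolding ball_measure_def by (intro monoI finite_measure_mono ball_sets) auto
      show "ball_measure M x (e (Suc (Suc n)) / 2) \<le> measure M (cf_cylinder n x)" for n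
        unfolding ball_measure_def using ball_subset_cf_cylinder[OF x, of n]
        by (intro finite_measure_mono cyl_sets) (auto simp: e_def)
      show "measure M (cf_cylinder n x) \<le> ball_measure M x (3 * e n)" for n
        unfolding ball_measure_def
      proof (intro finite_measure_mono ball_sets subsetI)
        fix y assume y: "y \<in> cf_cylinder n x"
        have "dist x y \<le> 2 * e n"
          using dist_cf_cylinder_le[OF x y] Lb(2)[of n] by (simp add: e_def)
        then show "y \<in> ball x (3 * e n) \<inter> space M"
          using epos[of n] cyl_sub[of n] y by (auto simp: space)
      qed
      show "(\<lambda>n. log_ext (measure M (cf_cylinder n x)) / ereal (ln (?L n))) \<longlonglongrightarrow> d"
        using d by (simp add: markov_quotient_def[abs_def])
    qed simp
    then have p: "(pointwise_quotient M x \<longlongrightarrow> d) (at_right 0)"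
      by (simp add: pointwise_quotient_def[abs_def])
    then show ?thesis
      using limI[OF d] tendsto_Lim[OF _ p]
      by (auto simp: pointwise_dim_exists_def markov_dim_def pointwise_dim_def)
  qed
  from part_a part_b show ?thesis by blast
qed

end
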